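(* Let $T=(V,E)$ be a finite tree with an arbitrary initial metric $w(0)\in\mathbb{R}_{>0}^{E}$, and let $w(t)$, $t\ge 0$, be the solution of the (unnormalized) Ricci flow $\frac{d}{dt}w_e(t)=-\kappa_e(t)\,w_e(t)$, $e\in E$. Then the flow converges, i.e. for every edge $h\in E$ the limit $\lim_{t\to\infty}w_h(t)$ exists in $[0,\infty]$ (possibly infinite). Moreover, if $e\in E$ is an edge with $\lim_{t\to\infty}w_e(t)=\infty$, then there is $t_0\ge 0$ such that $w_e(t)$ is increasing in $t$ on $[t_0,\infty)$.
   Context: Trees are finite and connected; $d_u$ is the degree of $u$. A metric is a weight vector $w\in\mathbb{R}_{>0}^{E}$, and $d(x,y)$ is the weighted path distance. The curvature is the Lin-Lu-Yau version of Ollivier Ricci curvature with parameter function $\gamma(x)=1/x$: for $\alpha\in[0,1]$ let $\mu_x^\alpha$ be the probability measure with $\mu_x^\alpha(x)=\alpha$, $\mu_x^\alpha(y)=(1-\alpha)\frac{1/w_{xy}}{D_x}$ for $y\sim x$, and $0$ otherwise, where $D_x=\sum_{z\sim x}1/w_{xz}$; with $W$ the $L^1$ transportation distance for $d$, set $\kappa_\alpha(x,y)=1-W(\mu_x^\alpha,\mu_y^\alpha)/d(x,y)$ and $\kappa_{xy}=\lim_{\alpha\to1}\kappa_\alpha(x,y)/(1-\alpha)$. On a tree, for an edge $uv$ this equals $$\kappa_{uv}=\frac{2-d_u}{w_{uv}D_u}+\frac{2-d_v}{w_{uv}D_v}.$$ $\kappa_e(t)$ is the curvature of $e$ with respect to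 $w(t)$. The Ricci flow has a unique positive solution for all $t\ge 0$ for any positive initial metric. *)

theory Defs
  imports "HOL-Analysis.Analysis"
begin

section \<open>Finite trees\<close>

text \<open>A finite simple graph is a vertex set \<open>V\<close> with a set \<open>E\<close> of two-element subsets of \<open>V\<close>.\<close>

definition finite_simple_graph :: "'a set \<Rightarrow> 'a set set \<Rightarrow> bool" where
  "finite_simple_graph V E \<longleftrightarrow>
     finite V \<and> (\<forall>e\<in>E. \<exists>u\<in>V. \<exists>v\<in>V. u \<noteq> v \<and> e = {u, v})"

definition neighbours :: "'a set set \<Rightarrow> 'a \<Rightarrow> 'a set" where
  "neighbours E x = {y. {x, y} \<in> E}"

text \<open>Paths and cycles are given by their lists of (distinct) vertices; a one-element list is the
  trivial path. The closing edge of a cycle, from the last to the first vertex, is not repeated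
  in the list.\<close>

definition graph_path :: "'a set \<Rightarrow> 'a set set \<Rightarrow> 'a \<Rightarrow> 'a list \<Rightarrow> 'a \<Rightarrow> bool" where
  "graph_path V E x p y \<longleftrightarrow>
     p \<noteq> [] \<and> set p \<subseteq> V \<and> distinct p \<and> hd p = x \<and> last p = y \<and>
     successively (\<lambda>a b. {a, b} \<in> E) p"

definition graph_cycle :: "'a set set \<Rightarrow> 'a list \<Rightarrow> bool" where
  "graph_cycle E c \<longleftrightarrow>
     3 \<le> length c \<and> distinct c \<and> successively (\<lambda>a b. {a, b} \<in> E) c \<and> {last c, hd c} \<in> E"

definition finite_tree :: "'a set \<Rightarrow> 'a set set \<Rightarrow> bool" where
  "finite_tree V E \<longleftrightarrow>
     finite_simple_graph V E \<and> V \<noteq> {} \<and>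
     (\<forall>x\<in>V. \<forall>y\<in>V. \<exists>p. graph_path V E x p y) \<and>
     (\<nexists>c. graph_cycle E c)"

section \<open>Weighted distance and transportation distance\<close>

definition path_length :: "('a set \<Rightarrow> real) \<Rightarrow> 'a list \<Rightarrow> real" where
  "path_length w p = (\<Sum>(a, b)\<leftarrow>zip p (tl p). w {a, b})"

definition graph_dist :: "'a set \<Rightarrow> 'a set set \<Rightarrow> ('a set \<Rightarrow> real) \<Rightarrow> 'a \<Rightarrow> 'a \<Rightarrow> real" where
  "graph_dist V E w x y = (INF p\<in>{p. graph_path V E x p y}. path_length w p)"

text \<open>Measures on the finite set \<open>V\<close> are represented by their mass functions; values
  outside \<open>V\<close> are irrelevant.\<close>

definition couplings :: "'a set \<Rightarrow> ('a \<Rightarrow> real) \<Rightarrow> ('a \<Rightarrow> real) \<Rightarrow> ('a \<Rightarrow> 'a \<Rightarrow> real) set" where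
  "couplings V \<mu> \<nu> = {\<pi>.
     (\<forall>x\<in>V. \<forall>y\<in>V. 0 \<le> \<pi> x y) \<and>
     (\<forall>x\<in>V. (\<Sum>y\<in>V. \<pi> x y) = \<mu> x) \<and>
     (\<forall>y\<in>V. (\<Sum>x\<in>V. \<pi> x y) = \<nu> y)}"

definition transport_dist ::
    "'a set \<Rightarrow> ('a \<Rightarrow> 'a \<Rightarrow> real) \<Rightarrow> ('a \<Rightarrow> real) \<Rightarrow> ('a \<Rightarrow> real) \<Rightarrow> real" where
  "transport_dist V d \<mu> \<nu> = (INF \<pi>\<in>couplings V \<mu> \<nu>. \<Sum>x\<in>V. \<Sum>y\<in>V. \<pi> x y * d x y)"

section \<open>Lin--Lu--Yau curvature\<close>

definition inverse_weight_sum :: "'a set set \<Rightarrow> ('a set \<Rightarrow> real) \<Rightarrow> 'a \<Rightarrow> real" where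
  "inverse_weight_sum E w x = (\<Sum>z\<in>neighbours E x. 1 / w {x, z})"

definition lazy_measure :: "'a set set \<Rightarrow> ('a set \<Rightarrow> real) \<Rightarrow> real \<Rightarrow> 'a \<Rightarrow> 'a \<Rightarrow> real" where
  "lazy_measure E w \<alpha> x y =
     (if y = x then \<alpha>
      else if y \<in> neighbours E x then (1 - \<alpha>) * ((1 / w {x, y}) / inverse_weight_sum E w x)
      else 0)"

definition lazy_curvature ::
    "'a set \<Rightarrow> 'a set set \<Rightarrow> ('a set \<Rightarrow> real) \<Rightarrow> real \<Rightarrow> 'a \<Rightarrow> 'a \<Rightarrow> real" where
  "lazy_curvature V E w \<alpha> x y =
     1 - transport_dist V (graph_dist V E w) (lazy_measure E w \<alpha> x) (lazy_measure E w \<alpha> y)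
         / graph_dist V E w x y"

definition lly_curvature ::
    "'a set \<Rightarrow> 'a set set \<Rightarrow> ('a set \<Rightarrow> real) \<Rightarrow> 'a \<Rightarrow> 'a \<Rightarrow> real" where
  "lly_curvature V E w x y = Lim (at_left 1) (\<lambda>\<alpha>. lazy_curvature V E w \<alpha> x y / (1 - \<alpha>))"

section \<open>Ricci flow\<close>

text \<open>A solution assigns to each time \<open>t \<ge> 0\<close> a positive weight vector \<open>w t\<close>; at \<open>t = 0\<close> the
  derivative is one-sided. The curvature is symmetric in the two endpoints, so ranging over both
  orientations of an edge imposes the same equation twice.\<close>

definition ricci_flow :: "'a set \<Rightarrow> 'a set set \<Rightarrow> (real \<Rightarrow> 'a set \<Rightarrow> real) \<Rightarrow> bool" where
  "ricci_flow V E w \<longleftrightarrow>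
     (\<forall>t\<ge>0. \<forall>e\<in>E. 0 < w t e) \<and>
     (\<forall>t\<ge>0. \<forall>x y. {x, y} \<in> E \<longrightarrow>
        ((\<lambda>s. w s {x, y}) has_real_derivative
           - lly_curvature V E (w t) x y * w t {x, y}) (at t within {0..}))"

end

theory Submission
  imports Defs
begin

text \<open>With \<open>r x = (d x - 2) / D x\<close> the flow reads \<open>w'(xy) = r x + r y\<close>. An edge without a leaf is
  nondecreasing, because then both rates are nonnegative. A leaf \<open>l\<close> has \<open>r l = - w(vl)\<close>, so
  differences of leaf edges at a common vertex \<open>v\<close> decay like \<open>exp (- t)\<close>, and it is enough to
  treat the longest one: once its derivative is positive it stays positive, so it is either
  decreasing forever or eventually increasing.\<close>

section \<open>Curvature on trees\<close>

text \<open>At a leaf edge vl the two terms of the derivative compete: r v is nonnegative once v has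
  degree at least 2, while r l is negative. The sign of the derivative of r v depends on all edges
  at v, and growth of a short leaf edge says nothing about the longer ones. Among the leaf edges at
  v the longest, vm, has the smallest derivative r v - w(vm); if that is positive, every edge at v
  grows, which is why the argument is run for vm. If it is never positive, w(vm) has a finite limit,
  and the other leaf edges at v inherit this limit without any claim that they are monotone. The
  rates r come from the definition of curvature: for \<alpha> near 1 an explicit coupling and an
  explicit potential certify each other's optimality.\<close>

lemma neighbours_sym: "y \<in> neighbours E x \<longleftrightarrow> x \<in> neighbours E y"
  by (simp add: neighbours_def insert_commute)

text \<open>Two paths that separate after \<open>x\<close> meet again, at the latest in
  \<open>y\<close>. The stretches from \<open>x\<close> to a first meeting point close up to a
  cycle.\<close>

lemma path_unique:
  assumes "\<nexists>c. graph_cycle E c" "graph_path V E x p y" "graph_path V E x q y"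
  shows "p = q"
  using assms(2,3)
proof (induction p arbitrary: x q)
  case Nil
  then show ?case by (simp add: graph_path_def)
next
  case (Cons a p)
  have "a = x" using Cons.prems(1) by (simp add: graph_path_def)
  obtain q' where q: "q = x # q'"
    using Cons.prems(2) by (cases q) (auto simp: graph_path_def)
  show ?case
  proof (cases "x = y")
    case True
    then have "p = []" "q' = []"
      using Cons.prems q \<open>a = x\<close> by (auto simp: graph_path_def split: if_splits)
    then show ?thesis using q \<open>a = x\<close> by simp
  next
    case False
    then have ne: "p \<noteq> []" "q' \<noteq> []"
      using Cons.prems q \<open>a = x\<close> by (auto simp: graph_path_def split: if_splits)
    have P: "graph_path V E (hd p) p y" "{x, hd p} \<in> E" "x \<notin> set p"
      using Cons.prems(1) ne \<open>a = x\<close> by (auto simp: graph_path_def successively_Cons)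
    have Q: "graph_path V E (hd q') q' y" "{x, hd q'} \<in> E" "x \<notin> set q'"
      using Cons.prems(2) ne q by (auto simp: graph_path_def successively_Cons)
    show ?thesis
    proof (cases "hd p = hd q'")
      case True
      then show ?thesis using Cons.IH P(1) Q(1) q \<open>a = x\<close> by simp
    next
      case neq: False
      have "\<exists>z\<in>set p. z \<in> set q'"
        using P(1) Q(1) ne by (metis graph_path_def last_in_set)
      \<comment> \<open>Choosing \<open>c\<close> as the first vertex of \<open>p\<close> on
        \<open>q'\<close> keeps \<open>p1\<close> disjoint from \<open>q'\<close>, so the cycle
        below repeats no vertex.\<close>
      then obtain p1 c p2 where p: "p = p1 @ c # p2" and "c \<in> set q'"
        and p1: "\<forall>z\<in>set p1. z \<notin> set q'"
        using split_list_first_prop[of p "\<lambda>z. z \<in> set q'"] by metis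
      obtain q1 q2 where q': "q' = q1 @ c # q2"
        using \<open>c \<in> set q'\<close> by (meson split_list)
      \<comment> \<open>One stretch has an interior vertex; with \<open>x\<close> and
        \<open>c\<close> this makes the three vertices that a cycle must have.\<close>
      have "p1 \<noteq> [] \<or> q1 \<noteq> []" using neq p q' by auto
      have sp: "successively (\<lambda>a b. {a, b} \<in> E) (x # p1 @ [c])"
        using P ne unfolding p graph_path_def
        by (cases p1) (auto simp: successively_Cons successively_append_iff hd_append)
      have sq: "successively (\<lambda>a b. {a, b} \<in> E) (x # q1 @ [c])"
        using Q ne unfolding q' graph_path_def
        by (cases q1) (auto simp: successively_Cons successively_append_iff hd_append)
      then have "successively (\<lambda>a b. {a, b} \<in> E) (rev (x # q1 @ [c]))"
        by (subst successively_rev) (simp add: insert_commute)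
      then have sq': "successively (\<lambda>a b. {a, b} \<in> E) (c # rev q1)" "{last (c # rev q1), x} \<in> E"
        by (auto simp: successively_append_iff successively_Cons hd_append split: if_splits)
      have "successively (\<lambda>a b. {a, b} \<in> E) ((x # p1) @ (c # rev q1))"
        using sp sq'(1) by (auto simp: successively_append_iff successively_Cons hd_append)
      moreover have "distinct (x # p1 @ c # rev q1)"
        using P Q p1 unfolding p q' graph_path_def by auto
      moreover have "3 \<le> length (x # p1 @ c # rev q1)"
        using \<open>p1 \<noteq> [] \<or> q1 \<noteq> []\<close> by (cases p1; cases q1) auto
      ultimately have "graph_cycle E (x # p1 @ c # rev q1)"
        using sq'(2) by (simp add: graph_cycle_def)
      then show ?thesis using assms(1) by blast
    qed
  qed
qed

lemma graph_dist_eq: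
  assumes "finite_tree V E" "graph_path V E x p y"
  shows "graph_dist V E w x y = path_length w p"
proof -
  have "\<nexists>c. graph_cycle E c" using assms(1) by (simp add: finite_tree_def)
  then have "q = p" if "graph_path V E x q y" for q
    using that assms(2) by (rule path_unique)
  then have "{p. graph_path V E x p y} = {p}" using assms(2) by blast
  then show ?thesis by (simp add: graph_dist_def)
qed

section \<open>Kantorovich duality on a finite set\<close>

text \<open>Weak duality and complementary slackness. An entry of a coupling is at most its row sum
  and its column sum, so \<open>\<pi>\<close> lives on the product of the supports; hence the bound
  on \<open>f\<close> is asked for only between the supports, and \<open>f\<close> may be arbitrary
  elsewhere.\<close>

lemma transport_cost_duality:
  assumes "finite V" "\<pi> \<in> couplings V \<mu> \<nu>"
    and "\<And>x y. x \<in> V \<Longrightarrow> y \<in> V \<Longrightarrow> \<mu> x \<noteq> 0 \<Longrightarrow> \<nu> y \<noteq> 0 \<Longrightarrow> f y - f x \<le> d x y"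
  shows "(\<Sum>y\<in>V. \<nu> y * f y) - (\<Sum>x\<in>V. \<mu> x * f x) \<le> (\<Sum>x\<in>V. \<Sum>y\<in>V. \<pi> x y * d x y)"
    and "(\<And>x y. x \<in> V \<Longrightarrow> y \<in> V \<Longrightarrow> \<pi> x y \<noteq> 0 \<Longrightarrow> f y - f x = d x y) \<Longrightarrow>
      (\<Sum>x\<in>V. \<Sum>y\<in>V. \<pi> x y * d x y) = (\<Sum>y\<in>V. \<nu> y * f y) - (\<Sum>x\<in>V. \<mu> x * f x)"
proof -
  have \<pi>: "\<And>x y. x \<in> V \<Longrightarrow> y \<in> V \<Longrightarrow> 0 \<le> \<pi> x y" "\<And>x. x \<in> V \<Longrightarrow> (\<Sum>y\<in>V. \<pi> x y) = \<mu> x"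
    "\<And>y. y \<in> V \<Longrightarrow> (\<Sum>x\<in>V. \<pi> x y) = \<nu> y"
    using assms(2) unfolding couplings_def by blast+
  have z: "\<mu> x \<noteq> 0 \<and> \<nu> y \<noteq> 0" if "x \<in> V" "y \<in> V" "\<pi> x y \<noteq> 0" for x y
  proof -
    have "\<pi> x y \<le> (\<Sum>y\<in>V. \<pi> x y)" "\<pi> x y \<le> (\<Sum>x\<in>V. \<pi> x y)"
      by (rule member_le_sum, use that \<pi>(1) assms(1) in simp_all)+
    then have "\<pi> x y \<le> \<mu> x" "\<pi> x y \<le> \<nu> y"
      unfolding \<pi>(2)[OF that(1)] \<pi>(3)[OF that(2)] by auto
    moreover have "0 < \<pi> x y" using \<pi>(1)[of x y] that by simp
    ultimately show ?thesis by auto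
  qed
  have "(\<Sum>y\<in>V. \<nu> y * f y) = (\<Sum>y\<in>V. \<Sum>x\<in>V. \<pi> x y * f y)"
    by (intro sum.cong refl) (simp add: \<pi>(3) flip: sum_distrib_right)
  also have "\<dots> = (\<Sum>x\<in>V. \<Sum>y\<in>V. \<pi> x y * f y)" by (rule sum.swap)
  finally have a: "(\<Sum>y\<in>V. \<nu> y * f y) = (\<Sum>x\<in>V. \<Sum>y\<in>V. \<pi> x y * f y)" .
  have b: "(\<Sum>x\<in>V. \<mu> x * f x) = (\<Sum>x\<in>V. \<Sum>y\<in>V. \<pi> x y * f x)"
    by (intro sum.cong refl) (simp add: \<pi>(2) flip: sum_distrib_right)
  have e: "(\<Sum>y\<in>V. \<nu> y * f y) - (\<Sum>x\<in>V. \<mu> x * f x) = (\<Sum>x\<in>V. \<Sum>y\<in>V. \<pi> x y * (f y - f x))"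
    unfolding a b by (simp add: sum_subtractf right_diff_distrib)
  show "(\<Sum>y\<in>V. \<nu> y * f y) - (\<Sum>x\<in>V. \<mu> x * f x) \<le> (\<Sum>x\<in>V. \<Sum>y\<in>V. \<pi> x y * d x y)"
    unfolding e
  proof (intro sum_mono)
    fix x y assume "x \<in> V" "y \<in> V"
    then show "\<pi> x y * (f y - f x) \<le> \<pi> x y * d x y"
      using z[of x y] assms(3)[of x y] \<pi>(1)[of x y]
      by (cases "\<pi> x y = 0") (auto intro: mult_left_mono)
  qed
  show "(\<Sum>x\<in>V. \<Sum>y\<in>V. \<pi> x y * d x y) = (\<Sum>y\<in>V. \<nu> y * f y) - (\<Sum>x\<in>V. \<mu> x * f x)"
    if "\<And>x y. x \<in> V \<Longrightarrow> y \<in> V \<Longrightarrow> \<pi> x y \<noteq> 0 \<Longrightarrow> f y - f x = d x y"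
    unfolding e using that by (intro sum.cong refl) (metis mult_zero_left)
qed

text \<open>A coupling that charges only pairs where the potential is tight attains the lower bound
  which the potential gives for all couplings.\<close>

lemma transport_dist_eq:
  assumes "finite V" "\<pi> \<in> couplings V \<mu> \<nu>"
    and "\<And>x y. x \<in> V \<Longrightarrow> y \<in> V \<Longrightarrow> \<mu> x \<noteq> 0 \<Longrightarrow> \<nu> y \<noteq> 0 \<Longrightarrow> f y - f x \<le> d x y"
    and "\<And>x y. x \<in> V \<Longrightarrow> y \<in> V \<Longrightarrow> \<pi> x y \<noteq> 0 \<Longrightarrow> f y - f x = d x y"
  shows "transport_dist V d \<mu> \<nu> = (\<Sum>y\<in>V. \<nu> y * f y) - (\<Sum>x\<in>V. \<mu> x * f x)"
  unfolding transport_dist_def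
proof (rule cInf_eq_minimum)
  show "(\<Sum>y\<in>V. \<nu> y * f y) - (\<Sum>x\<in>V. \<mu> x * f x)
      \<in> (\<lambda>\<pi>. \<Sum>x\<in>V. \<Sum>y\<in>V. \<pi> x y * d x y) ` couplings V \<mu> \<nu>"
    using transport_cost_duality(2)[OF assms(1,2,3,4)] assms(2) by (intro image_eqI[where x = \<pi>]) auto
qed (use transport_cost_duality(1)[OF assms(1) _ assms(3)] in auto)

text \<open>The share of one endpoint in the derivative of an edge weight: minus curvature times
  weight is the sum of this quantity over both endpoints.\<close>

definition vertex_rate :: "'a set set \<Rightarrow> ('a set \<Rightarrow> real) \<Rightarrow> 'a \<Rightarrow> real" where
  "vertex_rate E w x = (real (card (neighbours E x)) - 2) / inverse_weight_sum E w x"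

section \<open>Distance, transport and curvature for a fixed weight vector\<close>

locale weighted_tree =
  fixes V :: "'a set" and E :: "'a set set" and w :: "'a set \<Rightarrow> real"
  assumes tree: "finite_tree V E" and pos: "\<And>e. e \<in> E \<Longrightarrow> 0 < w e"
begin

lemma fin_V: "finite V" and edge_ends: "{x, y} \<in> E \<Longrightarrow> x \<in> V \<and> y \<in> V \<and> x \<noteq> y"
  using tree unfolding finite_tree_def finite_simple_graph_def by (auto simp: doubleton_eq_iff)

lemma neighbours_subset: "neighbours E x \<subseteq> V"
  using edge_ends by (auto simp: neighbours_def)

lemma not_neighbour_self: "x \<notin> neighbours E x"
  using edge_ends[of x x] by (auto simp: neighbours_def)

lemma finite_neighbours: "finite (neighbours E x)"
  using neighbours_subset fin_V finite_subset by blast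

text \<open>Keeps the neighbourhoods of adjacent vertices disjoint and the ends of the path in
  \<open>dist_three\<close> distinct.\<close>

lemma no_triangle: "{x, y} \<in> E \<Longrightarrow> {y, z} \<in> E \<Longrightarrow> {z, x} \<notin> E"
proof
  assume "{x, y} \<in> E" "{y, z} \<in> E" "{z, x} \<in> E"
  then have "graph_cycle E [x, y, z]"
    using edge_ends by (force simp: graph_cycle_def)
  then show False using tree by (auto simp: finite_tree_def)
qed

lemma dist_edge:
  assumes "{x, y} \<in> E"
  shows "graph_dist V E w x y = w {x, y}"
proof -
  have "graph_path V E x [x, y] y"
    using assms edge_ends[OF assms] by (simp add: graph_path_def)
  from graph_dist_eq[OF tree this] show ?thesis by (simp add: path_length_def)
qed

lemma dist_two:
  assumes "{x, y} \<in> E" "{y, z} \<in> E" "x \<noteq> z"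
  shows "graph_dist V E w x z = w {x, y} + w {y, z}"
proof -
  have "graph_path V E x [x, y, z] z"
    using assms edge_ends[OF assms(1)] edge_ends[OF assms(2)] by (simp add: graph_path_def)
  from graph_dist_eq[OF tree this] show ?thesis by (simp add: path_length_def)
qed

lemma dist_three:
  assumes "{x, y} \<in> E" "{y, z} \<in> E" "{z, t} \<in> E" "x \<noteq> z" "y \<noteq> t"
  shows "graph_dist V E w x t = w {x, y} + w {y, z} + w {z, t}"
proof -
  have "x \<noteq> t" using no_triangle[OF assms(1,2)] assms(3) by (auto simp: insert_commute)
  then have "graph_path V E x [x, y, z, t] t"
    using assms edge_ends[OF assms(1)] edge_ends[OF assms(2)] edge_ends[OF assms(3)]
    by (simp add: graph_path_def)
  from graph_dist_eq[OF tree this] show ?thesis by (simp add: path_length_def)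
qed

lemma dist_self: "x \<in> V \<Longrightarrow> graph_dist V E w x x = 0"
  using graph_dist_eq[OF tree, of x "[x]" x w] by (simp add: graph_path_def path_length_def)

lemma inverse_weight_sum_pos: "{x, y} \<in> E \<Longrightarrow> 0 < inverse_weight_sum E w x"
  unfolding inverse_weight_sum_def
  by (intro sum_pos finite_neighbours) (auto simp: neighbours_def pos)

lemma sum_lazy_measure:
  assumes "{x, y} \<in> E"
  shows "(\<Sum>z\<in>V. lazy_measure E w \<alpha> x z * f z) = \<alpha> * f x +
    (1 - \<alpha>) / inverse_weight_sum E w x * (\<Sum>z\<in>neighbours E x. f z / w {x, z})"
proof -
  have x: "x \<in> V" "x \<notin> neighbours E x"
    using edge_ends[OF assms] not_neighbour_self by auto
  have "(\<Sum>z\<in>V. lazy_measure E w \<alpha> x z * f z)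
      = (\<Sum>z\<in>insert x (neighbours E x). lazy_measure E w \<alpha> x z * f z)"
    using x neighbours_subset fin_V
    by (intro sum.mono_neutral_right) (auto simp: lazy_measure_def)
  also have "\<dots> = \<alpha> * f x + (\<Sum>z\<in>neighbours E x. lazy_measure E w \<alpha> x z * f z)"
    using x finite_neighbours by (simp add: lazy_measure_def)
  also have "(\<Sum>z\<in>neighbours E x. lazy_measure E w \<alpha> x z * f z) =
    (1 - \<alpha>) / inverse_weight_sum E w x * (\<Sum>z\<in>neighbours E x. f z / w {x, z})"
    unfolding sum_distrib_left using x by (intro sum.cong refl) (auto simp: lazy_measure_def)
  finally show ?thesis .
qed

lemma lazy_measure_mass: "{x, y} \<in> E \<Longrightarrow> (\<Sum>z\<in>V. lazy_measure E w \<alpha> x z) = 1"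
  using sum_lazy_measure[of x y \<alpha> "\<lambda>_. 1"] inverse_weight_sum_pos[of x y]
  by (simp flip: inverse_weight_sum_def)

lemma lazy_measure_self: "lazy_measure E w \<alpha> x x = \<alpha>"
  by (simp add: lazy_measure_def)

lemma lazy_measure_nonneg: "0 \<le> \<alpha> \<Longrightarrow> \<alpha> \<le> 1 \<Longrightarrow> 0 \<le> lazy_measure E w \<alpha> x y"
  using inverse_weight_sum_pos[of x y] pos[of "{x, y}"]
  by (auto simp: lazy_measure_def neighbours_def)

text \<open>All mass outside \<open>u\<close> goes to \<open>v\<close>, and all mass needed outside \<open>v\<close> comes from \<open>u\<close>.\<close>

lemma lazy_coupling:
  assumes uv: "{u, v} \<in> E" and \<alpha>: "1/2 \<le> \<alpha>" "\<alpha> \<le> 1"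
  shows "(\<lambda>a b. if a = u then if b = v then 2 * \<alpha> - 1 else lazy_measure E w \<alpha> v b
           else if b = v then lazy_measure E w \<alpha> u a else 0)
    \<in> couplings V (lazy_measure E w \<alpha> u) (lazy_measure E w \<alpha> v)" (is "?\<pi> \<in> couplings V ?\<mu> ?\<nu>")
proof -
  have V: "u \<in> V" "v \<in> V" "u \<noteq> v" using edge_ends[OF uv] by auto
  have vu: "{v, u} \<in> E" using uv by (simp add: insert_commute)
  \<comment> \<open>Each measure has mass 1 - \<alpha> off its centre. After \<open>u\<close> has
    supplied the vertices other than \<open>v\<close>, it keeps \<alpha> - (1 - \<alpha>) for
    \<open>v\<close>; this is nonnegative since \<alpha> is at least 1/2.\<close>
  have mass: "(\<Sum>a\<in>V - {u}. ?\<mu> a) = 1 - \<alpha>" "(\<Sum>b\<in>V - {v}. ?\<nu> b) = 1 - \<alpha>"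
    using lazy_measure_mass[OF uv, of \<alpha>] lazy_measure_mass[OF vu, of \<alpha>] V fin_V
      lazy_measure_self[of \<alpha>] by (simp_all add: sum_diff1)
  have "(\<Sum>b\<in>V. ?\<pi> a b) = ?\<mu> a" if "a \<in> V" for a
  proof (cases "a = u")
    case True
    have "(\<Sum>b\<in>V. ?\<pi> a b) = ?\<pi> a v + (\<Sum>b\<in>V - {v}. ?\<pi> a b)"
      by (rule sum.remove[OF fin_V V(2)])
    also have "(\<Sum>b\<in>V - {v}. ?\<pi> a b) = (\<Sum>b\<in>V - {v}. ?\<nu> b)"
      using True by (intro sum.cong) auto
    finally show ?thesis using mass True V by (simp add: lazy_measure_self)
  qed (use V fin_V in \<open>simp add: sum.delta\<close>)
  moreover have "(\<Sum>a\<in>V. ?\<pi> a b) = ?\<nu> b" if "b \<in> V" for b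
  proof (cases "b = v")
    case True
    have "(\<Sum>a\<in>V. ?\<pi> a b) = ?\<pi> u b + (\<Sum>a\<in>V - {u}. ?\<pi> a b)"
      by (rule sum.remove[OF fin_V V(1)])
    also have "(\<Sum>a\<in>V - {u}. ?\<pi> a b) = (\<Sum>a\<in>V - {u}. ?\<mu> a)"
      using True by (intro sum.cong) auto
    finally show ?thesis using mass True V by (simp add: lazy_measure_self)
  next
    case False
    then have "(\<Sum>a\<in>V. ?\<pi> a b) = (\<Sum>a\<in>V. if a = u then ?\<nu> b else 0)"
      by (intro sum.cong) auto
    then show ?thesis using V fin_V by simp
  qed
  ultimately show ?thesis
    using \<alpha> lazy_measure_nonneg[of \<alpha>] by (auto simp: couplings_def)
qed

lemma transport_dist_lazy:
  assumes uv: "{u, v} \<in> E" and \<alpha>: "1/2 \<le> \<alpha>" "\<alpha> \<le> 1"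
  shows "transport_dist V (graph_dist V E w) (lazy_measure E w \<alpha> u) (lazy_measure E w \<alpha> v)
    = w {u, v} + (1 - \<alpha>) * (vertex_rate E w u + vertex_rate E w v)"
proof -
  \<comment> \<open>The potential is a signed coordinate along the edge: 0 at \<open>u\<close>,
    increasing through \<open>v\<close>, negative on the other neighbours of \<open>u\<close>. The
    branch for \<open>v\<close> comes first because \<open>v\<close> is itself a neighbour of
    \<open>u\<close>; the last branch also covers vertices outside both supports, where the value is
    irrelevant.\<close>
  define f where "f x = (if x = v then w {u, v} else if x \<in> neighbours E u then - w {x, u}
    else if x = u then 0 else w {u, v} + w {v, x})" for x
  let ?N = "neighbours E" and ?D = "inverse_weight_sum E w"
  have vu: "{v, u} \<in> E" using uv by (simp add: insert_commute)
  have V: "u \<in> V" "v \<in> V" "u \<noteq> v" using edge_ends[OF uv] by auto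
  note un = not_neighbour_self[of u] not_neighbour_self[of v]
  have nt: "z \<notin> ?N u" if "z \<in> ?N v" for z
    using no_triangle[OF uv, of z] that by (auto simp: neighbours_def insert_commute)
  have fu: "f u = 0" and fv: "f v = w {u, v}"
    using V un by (auto simp: f_def)
  have fz: "f z = - w {z, u}" "{z, u} \<in> E" "z \<noteq> u" "{u, z} \<in> E" if "z \<in> ?N u" "z \<noteq> v" for z
    using that un by (auto simp: f_def neighbours_def insert_commute)
  have fy: "f y = w {u, v} + w {v, y}" "{v, y} \<in> E" "y \<noteq> v" if "y \<in> ?N v" "y \<noteq> u" for y
    using that un nt by (auto simp: f_def neighbours_def)
  have w0: "0 < w {u, v}" using pos uv by simp
  have wc: "w {v, u} = w {u, v}" by (simp add: insert_commute)
  \<comment> \<open>Equality fails only for \<open>a = v\<close>, \<open>b = u\<close>, that is, for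
    mass moved backwards along the edge, and the coupling avoids this pair.\<close>
  have cases: "f b - f a \<le> graph_dist V E w a b \<and>
      (a = u \<or> b = v \<longrightarrow> f b - f a = graph_dist V E w a b)"
    if a: "a = u \<or> a \<in> ?N u" and b: "b = v \<or> b \<in> ?N v" for a b
  proof -
    consider "a = u" | "a = v" | "a \<in> ?N u" "a \<noteq> v" using a by blast
    then show ?thesis
    proof cases
      case 1
      consider "b = u" | "b = v" | "b \<in> ?N v" "b \<noteq> u" using b by blast
      then show ?thesis
      proof cases
        case 3
        then show ?thesis
          using 1 V fu fy(1)[OF 3] dist_two[OF uv fy(2)[OF 3]] by simp
      qed (use 1 V fu fv dist_self dist_edge[OF uv] in simp_all)
    next
      case 2
      consider "b = u" | "b = v" | "b \<in> ?N v" "b \<noteq> u" using b by blast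
      then show ?thesis
      proof cases
        case 3
        then show ?thesis
          using 2 V fv fy(1,3)[OF 3] dist_edge[OF fy(2)[OF 3]] by simp
      qed (use 2 V fu fv dist_self dist_edge[OF vu] w0 wc in simp_all)
    next
      case a: 3
      consider "b = u" | "b = v" | "b \<in> ?N v" "b \<noteq> u" using b by blast
      then show ?thesis
      proof cases
        case 3
        then show ?thesis
          using a fz(1,3)[OF a] fy(1,3)[OF 3] dist_three[OF fz(2)[OF a] uv fy(2)[OF 3]] by simp
      qed (use a V fu fv fz(1,3)[OF a] dist_edge[OF fz(2)[OF a]] dist_two[OF fz(2)[OF a] uv]
          in simp_all)
    qed
  qed
  have supp: "a = x \<or> a \<in> ?N x" if "lazy_measure E w \<alpha> x a \<noteq> 0" for a x
    using that by (auto simp: lazy_measure_def split: if_splits)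
  have "transport_dist V (graph_dist V E w) (lazy_measure E w \<alpha> u) (lazy_measure E w \<alpha> v) =
    (\<Sum>y\<in>V. lazy_measure E w \<alpha> v y * f y) - (\<Sum>x\<in>V. lazy_measure E w \<alpha> u x * f x)"
  proof (rule transport_dist_eq[OF fin_V lazy_coupling[OF uv \<alpha>]])
    fix x y assume "(if x = u then if y = v then 2 * \<alpha> - 1 else lazy_measure E w \<alpha> v y
           else if y = v then lazy_measure E w \<alpha> u x else 0) \<noteq> 0"
    then show "f y - f x = graph_dist V E w x y"
      using cases[of x y] supp[of v y] supp[of u x] by (auto split: if_splits)
  qed (use cases supp in blast)
  also have "(\<Sum>y\<in>V. lazy_measure E w \<alpha> v y * f y) =
      \<alpha> * w {u, v} + (1 - \<alpha>) * (w {u, v} + vertex_rate E w v)"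
  proof -
    \<comment> \<open>The general term is (w(uv) + w(vz)) / w(vz). At \<open>z = u\<close> it would
      be 2 whereas \<open>f u\<close> is 0; this correction is the 2 in
      \<open>vertex_rate\<close>.\<close>
    have "(\<Sum>z\<in>?N v. f z / w {v, z})
      = (\<Sum>z\<in>?N v. w {u, v} * (1 / w {v, z}) + 1 - (if z = u then 2 else 0))"
    proof (intro sum.cong refl)
      fix z assume z: "z \<in> ?N v"
      then have "0 < w {v, z}" using pos by (simp add: neighbours_def)
      then show "f z / w {v, z} = w {u, v} * (1 / w {v, z}) + 1 - (if z = u then 2 else 0)"
        using fy[of z] z fu wc by (auto simp: add_divide_distrib)
    qed
    also have "\<dots> = w {u, v} * ?D v + card (?N v) - 2"
      using vu finite_neighbours
      by (simp add: sum_subtractf sum.distrib sum_distrib_left inverse_weight_sum_def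
          sum.delta' neighbours_def)
    finally have S: "(\<Sum>z\<in>?N v. f z / w {v, z}) = w {u, v} * ?D v + card (?N v) - 2" .
    show ?thesis
      unfolding sum_lazy_measure[OF vu] fv S
      using inverse_weight_sum_pos[OF vu] by (simp add: vertex_rate_def field_simps)
  qed
  also have "(\<Sum>x\<in>V. lazy_measure E w \<alpha> u x * f x) = - (1 - \<alpha>) * vertex_rate E w u"
  proof -
    \<comment> \<open>Each neighbour of \<open>u\<close> contributes -1 except \<open>v\<close>,
      which contributes 1 = 2 - 1.\<close>
    have "(\<Sum>z\<in>?N u. f z / w {u, z}) = (\<Sum>z\<in>?N u. (if z = v then 2 else 0) - 1)"
    proof (intro sum.cong refl)
      fix z assume z: "z \<in> ?N u"
      then have "0 < w {u, z}" using pos by (simp add: neighbours_def)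
      then show "f z / w {u, z} = (if z = v then 2 else 0) - 1"
        using fz[of z] z fv by (auto simp: insert_commute)
    qed
    also have "\<dots> = 2 - real (card (?N u))"
      using uv finite_neighbours by (simp add: sum_subtractf sum.delta' neighbours_def)
    finally have S: "(\<Sum>z\<in>?N u. f z / w {u, z}) = 2 - real (card (?N u))" .
    show ?thesis
      unfolding sum_lazy_measure[OF uv] fu S
      using inverse_weight_sum_pos[OF uv] by (simp add: vertex_rate_def field_simps)
  qed
  finally show ?thesis by (simp add: algebra_simps)
qed

text \<open>For \<alpha> between 1/2 and 1 the transport distance is affine in 1 - \<alpha> with
  value w(uv) at \<alpha> = 1, so the quotient defining the curvature is constant there and equals
  its limit.\<close>

lemma lly_curvature_eq:
  assumes uv: "{u, v} \<in> E"
  shows "- lly_curvature V E w u v * w {u, v} = vertex_rate E w u + vertex_rate E w v"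
proof -
  have w0: "0 < w {u, v}" using pos uv by simp
  let ?k = "- (vertex_rate E w u + vertex_rate E w v) / w {u, v}"
  have "\<forall>\<^sub>F \<alpha> in at_left 1. lazy_curvature V E w \<alpha> u v / (1 - \<alpha>) = ?k"
    using eventually_at_left_real[of "1/2" "1::real"]
  proof (rule eventually_mono)
    show "1 / 2 < (1::real)" by simp
    fix \<alpha> :: real assume "\<alpha> \<in> {1/2<..<1}"
    then show "lazy_curvature V E w \<alpha> u v / (1 - \<alpha>) = ?k"
      using w0 transport_dist_lazy[OF uv, of \<alpha>] dist_edge[OF uv]
      by (simp add: lazy_curvature_def divide_simps)
  qed
  then have "((\<lambda>\<alpha>. lazy_curvature V E w \<alpha> u v / (1 - \<alpha>)) \<longlongrightarrow> ?k) (at_left 1)"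
    by (rule tendsto_eventually)
  then have "lly_curvature V E w u v = ?k"
    unfolding lly_curvature_def by (intro tendsto_Lim) auto
  then show ?thesis using w0 by simp
qed

end

section \<open>Monotonicity along the flow\<close>

text \<open>As long as \<open>g\<close> is nonnegative, \<open>g t * exp t\<close> is nondecreasing,
  so \<open>g\<close> cannot reach 0 in finite time.\<close>

lemma positivity_persists:
  fixes g g' :: "real \<Rightarrow> real"
  assumes "\<And>t. a \<le> t \<Longrightarrow> (g has_real_derivative g' t) (at t within {a..})"
    and "\<And>t. a \<le> t \<Longrightarrow> 0 \<le> g t \<Longrightarrow> - g t \<le> g' t"
    and "0 < g a" "a \<le> t"
  shows "0 < g t"
proof (rule ccontr)
  assume "\<not> 0 < g t"
  define S where "S = {s \<in> {a..}. g s \<in> {..0}}"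
  have cont: "continuous_on {a..} g"
    using assms(1) by (intro DERIV_continuous_on) auto
  have S: "S \<noteq> {}" "closed S" "bdd_below S"
    using \<open>\<not> 0 < g t\<close> assms(4) continuous_on_closed_Collect_le[OF cont, of "\<lambda>_. 0"]
    by (auto simp: S_def bdd_below_def intro!: continuous_intros)
  \<comment> \<open>The first time at which \<open>g\<close> is not positive; it is attained because
    \<open>S\<close> is closed.\<close>
  define T where "T = Inf S"
  have "T \<in> S" using S closed_contains_Inf T_def by blast
  then have T: "a \<le> T" "g T \<le> 0" by (auto simp: S_def)
  have nonneg: "0 \<le> g s" if "s \<in> {a..<T}" for s
    using cInf_lower[OF _ S(3), of s] that by (force simp: S_def T_def)
  have "g a * exp a \<le> g T * exp T"
  proof (rule DERIV_nonneg_imp_increasing_open[where f = "\<lambda>t. g t * exp t"])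
    show "a \<le> T" by fact
    show "continuous_on {a..T} (\<lambda>t. g t * exp t)"
      by (intro continuous_intros continuous_on_subset[OF cont]) auto
    fix s assume s: "a < s" "s < T"
    then have "at s within {a..} = at s" by (intro at_within_interior) auto
    then have "((\<lambda>t. g t * exp t) has_real_derivative (g' s + g s) * exp s) (at s)"
      using assms(1)[of s] s by (auto intro!: derivative_eq_intros simp: algebra_simps)
    moreover have "0 \<le> (g' s + g s) * exp s"
      using assms(2)[of s] nonneg[of s] s by (intro mult_nonneg_nonneg) auto
    ultimately show "\<exists>y. ((\<lambda>t. g t * exp t) has_real_derivative y) (at s) \<and> 0 \<le> y" by blast
  qed
  moreover have "0 < g a * exp a" using assms(3) by simp
  ultimately show False using T by (metis exp_gt_zero not_le order_less_le_trans zero_less_mult_pos2)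
qed

lemma strict_mono_if_deriv_pos:
  fixes f f' :: "real \<Rightarrow> real"
  assumes "\<And>t. a \<le> t \<Longrightarrow> (f has_real_derivative f' t) (at t within {a..})"
    and "\<And>t. a \<le> t \<Longrightarrow> 0 < f' t"
  shows "strict_mono_on {a..} f"
proof (rule strict_mono_onI)
  fix r s assume rs: "r \<in> {a..}" "s \<in> {a..}" "r < s"
  have "continuous_on {a..} f" using assms(1) by (intro DERIV_continuous_on) auto
  then have c: "continuous_on {r..s} f" using rs by (elim continuous_on_subset) auto
  show "f r < f s"
  proof (rule DERIV_pos_imp_increasing_open[OF rs(3) _ c])
    fix x assume "r < x" "x < s"
    then have "at x within {a..} = at x" "a \<le> x" using rs by (auto intro!: at_within_interior)
    then show "\<exists>y. (f has_real_derivative y) (at x) \<and> 0 < y"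
      using assms[of x] by auto
  qed
qed

lemma antimono_if_deriv_nonpos:
  fixes f f' :: "real \<Rightarrow> real"
  assumes "\<And>t. a \<le> t \<Longrightarrow> (f has_real_derivative f' t) (at t within {a..})"
    and "\<And>t. a \<le> t \<Longrightarrow> f' t \<le> 0" "a \<le> r" "r \<le> s"
  shows "f s \<le> f r"
proof (rule DERIV_nonpos_imp_decreasing_open[OF assms(4)])
  have "continuous_on {a..} f" using assms(1) by (intro DERIV_continuous_on) auto
  then show "continuous_on {r..s} f" using assms(3) by (elim continuous_on_subset) auto
  fix x assume "r < x" "x < s"
  then have "at x within {a..} = at x" "a \<le> x" using assms(3) by (auto intro!: at_within_interior)
  then show "\<exists>y. (f has_real_derivative y) (at x) \<and> y \<le> 0"
    using assms(1,2)[of x] by auto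
qed

lemma mono_tendsto_ereal:
  fixes f :: "real \<Rightarrow> real"
  assumes "\<And>r s. a \<le> r \<Longrightarrow> r \<le> s \<Longrightarrow> f r \<le> f s"
  obtains L where "((\<lambda>t. ereal (f t)) \<longlongrightarrow> L) at_top"
proof -
  have "((\<lambda>t. ereal (f t)) \<longlongrightarrow> (SUP t\<in>{a..}. ereal (f t))) at_top"
  proof (rule order_tendstoI)
    fix y assume "y < (SUP t\<in>{a..}. ereal (f t))"
    then obtain t where "a \<le> t" "y < ereal (f t)" by (auto simp: less_SUP_iff)
    then show "\<forall>\<^sub>F t in at_top. y < ereal (f t)"
      using assms by (intro eventually_at_top_linorderI[of t]) (meson ereal_less_eq(3) order_less_le_trans)
  next
    fix y assume y: "(SUP t\<in>{a..}. ereal (f t)) < y"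
    have "ereal (f t) < y" if "a \<le> t" for t
      using that by (intro le_less_trans[OF _ y] SUP_upper) auto
    then show "\<forall>\<^sub>F t in at_top. ereal (f t) < y"
      by (intro eventually_at_top_linorderI[of a])
  qed
  then show ?thesis using that by blast
qed

lemma antimono_tendsto:
  fixes f :: "real \<Rightarrow> real"
  assumes "\<And>r s. a \<le> r \<Longrightarrow> r \<le> s \<Longrightarrow> f s \<le> f r" "\<And>t. a \<le> t \<Longrightarrow> 0 \<le> f t"
  obtains L :: real where "(f \<longlongrightarrow> L) at_top"
proof -
  obtain L where L: "((\<lambda>t. ereal (- f t)) \<longlongrightarrow> L) at_top"
    using mono_tendsto_ereal[of a "\<lambda>t. - f t"] assms(1) by auto
  have "L \<le> 0"
    using L by (rule tendsto_upperbound)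
      (use assms(2) in \<open>auto intro!: eventually_at_top_linorderI[of a]\<close>)
  moreover have "ereal (- f a) \<le> L"
    using L by (rule tendsto_lowerbound)
      (use assms(1) in \<open>auto intro!: eventually_at_top_linorderI[of a]\<close>)
  ultimately obtain l where "L = ereal l" by (cases L) auto
  then have "((\<lambda>t. - f t) \<longlongrightarrow> l) at_top" using L by simp
  then have "(f \<longlongrightarrow> - l) at_top" using tendsto_minus by fastforce
  then show ?thesis using that by blast
qed

text \<open>Both claims of the theorem for a single edge. Strict growth is tied to an infinite
  limit, so an edge with a finite limit qualifies without being monotone.\<close>

definition eventually_monotone_limit :: "(real \<Rightarrow> real) \<Rightarrow> bool" where
  "eventually_monotone_limit f \<longleftrightarrow>
     (\<exists>L::ereal. 0 \<le> L \<and> ((\<lambda>t. ereal (f t)) \<longlongrightarrow> L) at_top) \<and>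
     (((\<lambda>t. ereal (f t)) \<longlongrightarrow> \<infinity>) at_top \<longrightarrow> (\<exists>t0\<ge>0. strict_mono_on {t0..} f))"

lemma eventually_monotone_limitI_pos:
  fixes f f' :: "real \<Rightarrow> real"
  assumes deriv: "\<And>t. 0 \<le> t \<Longrightarrow> (f has_real_derivative f' t) (at t within {0..})"
    and "\<And>t. 0 \<le> t \<Longrightarrow> 0 \<le> f t" "0 \<le> t0" "\<And>t. t0 \<le> t \<Longrightarrow> 0 < f' t"
  shows "eventually_monotone_limit f"
proof -
  have sm: "strict_mono_on {t0..} f"
    using assms(3,4) by (intro strict_mono_if_deriv_pos[of t0 f f'])
      (auto intro: has_field_derivative_subset[OF deriv])
  then have "f r \<le> f s" if "t0 \<le> r" "r \<le> s" for r s
    using that by (auto dest!: strict_mono_onD[of _ _ r s] simp: le_less)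
  then obtain L where L: "((\<lambda>t. ereal (f t)) \<longlongrightarrow> L) at_top"
    using mono_tendsto_ereal by blast
  have "0 \<le> L"
    using L by (rule tendsto_lowerbound)
      (use assms(2) in \<open>auto intro!: eventually_at_top_linorderI[of 0]\<close>)
  then show ?thesis using L sm assms(3) by (auto simp: eventually_monotone_limit_def)
qed

lemma eventually_monotone_limitI_finite:
  assumes "(f \<longlongrightarrow> L) at_top" "\<And>t. 0 \<le> t \<Longrightarrow> 0 \<le> f t"
  shows "eventually_monotone_limit f"
proof -
  have L: "((\<lambda>t. ereal (f t)) \<longlongrightarrow> ereal L) at_top" using assms(1) by simp
  then have "\<not> ((\<lambda>t. ereal (f t)) \<longlongrightarrow> \<infinity>) at_top"
    using tendsto_unique[OF _ L, of \<infinity>] by auto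
  moreover have "0 \<le> L"
    using assms(1) by (rule tendsto_lowerbound)
      (use assms(2) in \<open>auto intro!: eventually_at_top_linorderI[of 0]\<close>)
  ultimately show ?thesis
    unfolding eventually_monotone_limit_def using L
    by (intro conjI exI[of _ "ereal L"] impI) auto
qed

lemma deriv_nonpos_tendsto:
  fixes f f' :: "real \<Rightarrow> real"
  assumes "\<And>t. 0 \<le> t \<Longrightarrow> (f has_real_derivative f' t) (at t within {0..})"
    and "\<And>t. 0 \<le> t \<Longrightarrow> 0 \<le> f t" "\<And>t. 0 \<le> t \<Longrightarrow> f' t \<le> 0"
  obtains L :: real where "(f \<longlongrightarrow> L) at_top"
proof (rule antimono_tendsto)
  show "f s \<le> f r" if "0 \<le> r" "r \<le> s" for r s
    using assms(1,3) that by (rule antimono_if_deriv_nonpos)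
qed (use assms(2) that in auto)

section \<open>Internal edges and leaf edges under the flow\<close>

locale tree_ricci_flow =
  fixes V :: "'a set" and E :: "'a set set" and w :: "real \<Rightarrow> 'a set \<Rightarrow> real"
  assumes tree: "finite_tree V E" and flow: "ricci_flow V E w"
begin

lemma weighted_tree: "0 \<le> t \<Longrightarrow> weighted_tree V E (w t)"
  using tree flow by unfold_locales (auto simp: ricci_flow_def)

lemma weight_pos: "0 \<le> t \<Longrightarrow> e \<in> E \<Longrightarrow> 0 < w t e"
  using flow by (auto simp: ricci_flow_def)

lemma finite_neighbours: "finite (neighbours E x)"
  using weighted_tree.finite_neighbours[OF weighted_tree[of 0]] by simp

lemma degree_pos: "{x, y} \<in> E \<Longrightarrow> 1 \<le> card (neighbours E x)"
  using finite_neighbours[of x] by (auto simp: neighbours_def Suc_le_eq card_gt_0_iff)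

lemma inverse_weight_sum_pos: "0 \<le> t \<Longrightarrow> {x, y} \<in> E \<Longrightarrow> 0 < inverse_weight_sum E (w t) x"
  using weighted_tree.inverse_weight_sum_pos[OF weighted_tree] by blast

text \<open>The curvature formula at each time turns the flow into an explicit differential
  equation; curvature enters the rest of the argument only through it.\<close>

lemma weight_deriv:
  assumes "0 \<le> t" "{x, y} \<in> E"
  shows "((\<lambda>s. w s {x, y}) has_real_derivative vertex_rate E (w t) x + vertex_rate E (w t) y)
    (at t within {0..})"
  unfolding weighted_tree.lly_curvature_eq[OF weighted_tree[OF assms(1)] assms(2), symmetric]
  using flow assms by (simp add: ricci_flow_def)

lemma vertex_rate_leaf:
  assumes "0 \<le> t" "{x, y} \<in> E" "card (neighbours E y) = 1"
  shows "vertex_rate E (w t) y = - w t {x, y}"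
proof -
  have "x \<in> neighbours E y" using assms(2) by (simp add: neighbours_def insert_commute)
  then have "neighbours E y = {x}" using assms(3) by (metis card_1_singletonE singletonD)
  then show ?thesis
    using weight_pos[OF assms(1,2)]
    by (simp add: vertex_rate_def inverse_weight_sum_def insert_commute)
qed

lemma vertex_rate_nonneg:
  assumes "0 \<le> t" "{x, y} \<in> E" "2 \<le> card (neighbours E x)"
  shows "0 \<le> vertex_rate E (w t) x"
  using inverse_weight_sum_pos[OF assms(1,2)] assms(3) by (simp add: vertex_rate_def)

text \<open>The numerators in the sum are the derivatives of the edges at \<open>x\<close>. So when
  the degree is at least 2 and all edges at \<open>x\<close> are growing, the rate of
  \<open>x\<close> does not decrease.\<close>

lemma vertex_rate_deriv:
  assumes "0 \<le> t" "{x, y} \<in> E"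
  shows "((\<lambda>s. vertex_rate E (w s) x) has_real_derivative
    (real (card (neighbours E x)) - 2) / (inverse_weight_sum E (w t) x)\<^sup>2 *
    (\<Sum>z\<in>neighbours E x. (vertex_rate E (w t) x + vertex_rate E (w t) z) / (w t {x, z})\<^sup>2))
    (at t within {0..})"
proof -
  have "((\<lambda>s. inverse_weight_sum E (w s) x) has_real_derivative
      (\<Sum>z\<in>neighbours E x. - ((vertex_rate E (w t) x + vertex_rate E (w t) z) / (w t {x, z})\<^sup>2)))
      (at t within {0..})"
    unfolding inverse_weight_sum_def
  proof (rule DERIV_sum)
    fix z assume "z \<in> neighbours E x"
    then have z: "{x, z} \<in> E" by (simp add: neighbours_def)
    show "((\<lambda>s. 1 / w s {x, z}) has_real_derivative
        - ((vertex_rate E (w t) x + vertex_rate E (w t) z) / (w t {x, z})\<^sup>2)) (at t within {0..})"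
      using weight_pos[OF assms(1) z]
      by (auto intro!: derivative_eq_intros weight_deriv[OF assms(1) z]
          simp: power2_eq_square diff_divide_distrib add_divide_distrib)
  qed
  from DERIV_divide[OF DERIV_const this, of "real (card (neighbours E x)) - 2"]
  show ?thesis
    unfolding vertex_rate_def[of E "w _" x, abs_def]
    using inverse_weight_sum_pos[OF assms]
    by (simp add: vertex_rate_def power2_eq_square sum_negf)
qed

lemma internal_edge:
  assumes "{x, y} \<in> E" "2 \<le> card (neighbours E x)" "2 \<le> card (neighbours E y)"
  shows "eventually_monotone_limit (\<lambda>t. w t {x, y})"
proof (cases "card (neighbours E x) = 2 \<and> card (neighbours E y) = 2")
  case True
  then have "vertex_rate E (w t) x + vertex_rate E (w t) y \<le> 0" for t
    by (simp add: vertex_rate_def)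
  then obtain L where "((\<lambda>t. w t {x, y}) \<longlongrightarrow> L) at_top"
    using deriv_nonpos_tendsto[OF weight_deriv[OF _ assms(1)]] weight_pos assms(1)
    by (metis less_imp_le)
  then show ?thesis
    using eventually_monotone_limitI_finite weight_pos assms(1) by (metis less_imp_le)
next
  case False
  have yx: "{y, x} \<in> E" using assms(1) by (simp add: insert_commute)
  have "0 < vertex_rate E (w t) x + vertex_rate E (w t) y" if "0 \<le> t" for t
  proof -
    have "0 < vertex_rate E (w t) x \<or> 0 < vertex_rate E (w t) y"
      using False assms inverse_weight_sum_pos[OF that assms(1)] inverse_weight_sum_pos[OF that yx]
      by (auto simp: vertex_rate_def)
    then show ?thesis
      using vertex_rate_nonneg[OF that assms(1,2)] vertex_rate_nonneg[OF that yx assms(3)]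
      by linarith
  qed
  then show ?thesis
    using eventually_monotone_limitI_pos[OF weight_deriv[OF _ assms(1)], of 0] weight_pos assms(1)
    by (simp add: less_imp_le)
qed

text \<open>The rate of \<open>v\<close> cancels in the difference, which therefore solves d' = - d.
  In particular its sign is constant, so the longest leaf edge can be selected once and for all at
  time 0.\<close>

lemma leaf_difference:
  assumes "{v, l} \<in> E" "card (neighbours E l) = 1" "{v, m} \<in> E" "card (neighbours E m) = 1"
    and "0 \<le> t"
  shows "w t {v, m} - w t {v, l} = (w 0 {v, m} - w 0 {v, l}) * exp (- t)"
proof -
  let ?d = "\<lambda>t. (w t {v, m} - w t {v, l}) * exp t"
  have "(?d has_real_derivative 0) (at s within {0..})" if "s \<in> {0..}" for s
    using that vertex_rate_leaf[OF _ assms(1,2), of s] vertex_rate_leaf[OF _ assms(3,4), of s]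
    by (auto intro!: derivative_eq_intros weight_deriv[OF _ assms(1)] weight_deriv[OF _ assms(3)]
        simp: algebra_simps)
  then have "\<exists>c. \<forall>s\<in>{0..}. ?d s = c"
    by (intro has_field_derivative_zero_constant) auto
  then have "?d t = ?d 0" using assms(5) by (metis atLeast_iff order_refl)
  then show ?thesis by (simp add: exp_minus field_simps)
qed

text \<open>For the longest leaf edge \<open>vm\<close> at \<open>v\<close>, every other edge at \<open>v\<close> grows whenever \<open>vm\<close> does,
  and then so does the vertex rate of \<open>v\<close>. Hence \<open>g = w'(vm)\<close> satisfies \<open>g' \<ge> - g\<close> wherever
  \<open>g \<ge> 0\<close>.\<close>

lemma longest_leaf_rate_persists:
  assumes m: "{v, m} \<in> E" "card (neighbours E m) = 1" and v: "2 \<le> card (neighbours E v)"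
    and longest: "\<And>l. {v, l} \<in> E \<Longrightarrow> card (neighbours E l) = 1 \<Longrightarrow> w 0 {v, l} \<le> w 0 {v, m}"
    and "0 \<le> t0" "0 < vertex_rate E (w t0) v - w t0 {v, m}" "t0 \<le> t"
  shows "0 < vertex_rate E (w t) v - w t {v, m}"
proof (rule positivity_persists[where a = t0 and g = "\<lambda>t. vertex_rate E (w t) v - w t {v, m}"])
  fix s assume "t0 \<le> s"
  then have s: "0 \<le> s" using assms(5) by simp
  let ?g = "vertex_rate E (w s) v - w s {v, m}"
  let ?r = "(real (card (neighbours E v)) - 2) / (inverse_weight_sum E (w s) v)\<^sup>2 *
    (\<Sum>z\<in>neighbours E v. (vertex_rate E (w s) v + vertex_rate E (w s) z) / (w s {v, z})\<^sup>2)"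
  show "((\<lambda>t. vertex_rate E (w t) v - w t {v, m}) has_real_derivative ?r - ?g) (at s within {t0..})"
  proof (rule has_field_derivative_subset)
    \<comment> \<open>As \<open>m\<close> is a leaf, the derivative of the weight of vm is
      \<open>?g\<close> itself; this produces the term \<open>- ?g\<close>.\<close>
    have "vertex_rate E (w s) v + vertex_rate E (w s) m = ?g"
      using vertex_rate_leaf[OF s m] by simp
    then show "((\<lambda>t. vertex_rate E (w t) v - w t {v, m}) has_real_derivative ?r - ?g)
        (at s within {0..})"
      using DERIV_diff[OF vertex_rate_deriv[OF s m(1)] weight_deriv[OF s m(1)]] by (simp only:)
  qed (use assms(5) in auto)
  assume g: "0 \<le> ?g"
  have "0 \<le> vertex_rate E (w s) v + vertex_rate E (w s) z" if "z \<in> neighbours E v" for z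
  proof -
    have z: "{v, z} \<in> E" "{z, v} \<in> E" using that by (auto simp: neighbours_def insert_commute)
    show ?thesis
    proof (cases "card (neighbours E z) = 1")
      case True
      \<comment> \<open>The order of the leaf edges at time 0 persists, so vz has at least the
        derivative of vm.\<close>
      have "w s {v, m} - w s {v, z} \<ge> 0"
        using leaf_difference[OF z(1) True m s] longest[OF z(1) True] by simp
      then show ?thesis using vertex_rate_leaf[OF s z(1) True] g by simp
    next
      case False
      then have "2 \<le> card (neighbours E z)" using degree_pos[OF z(2)] by simp
      then show ?thesis
        using vertex_rate_nonneg[OF s z(2)] vertex_rate_nonneg[OF s z(1) v] by simp
    qed
  qed
  then have "0 \<le> ?r" using v by (intro mult_nonneg_nonneg sum_nonneg) auto
  then show "- ?g \<le> ?r - ?g" by simp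
qed (use assms in auto)

lemma leaf_edge:
  assumes l: "{v, l} \<in> E" "card (neighbours E l) = 1"
  shows "eventually_monotone_limit (\<lambda>t. w t {v, l})"
proof (cases "card (neighbours E v) = 1")
  \<comment> \<open>Here \<open>v\<close> is a leaf too, and both rates are minus the
    weight.\<close>
  case True
  have lv: "{l, v} \<in> E" using l by (simp add: insert_commute)
  have "vertex_rate E (w t) v + vertex_rate E (w t) l \<le> 0" if "0 \<le> t" for t
    using vertex_rate_leaf[OF that l] vertex_rate_leaf[OF that lv True]
      weight_pos[OF that l(1)] weight_pos[OF that lv] by simp
  then obtain L where "((\<lambda>t. w t {v, l}) \<longlongrightarrow> L) at_top"
    using deriv_nonpos_tendsto[OF weight_deriv[OF _ l(1)]] weight_pos l(1)
    by (metis less_imp_le)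
  then show ?thesis
    using eventually_monotone_limitI_finite weight_pos l(1) by (metis less_imp_le)
next
  case False
  then have v: "2 \<le> card (neighbours E v)" using degree_pos[OF l(1)] by simp
  define A where "A = {z \<in> neighbours E v. card (neighbours E z) = 1}"
  have A: "finite A" "A \<noteq> {}" using l finite_neighbours by (auto simp: A_def neighbours_def)
  then have "Max ((\<lambda>z. w 0 {v, z}) ` A) \<in> (\<lambda>z. w 0 {v, z}) ` A" by (intro Max_in) auto
  then obtain m where "m \<in> A" and "Max ((\<lambda>z. w 0 {v, z}) ` A) = w 0 {v, m}" by auto
  moreover have "w 0 {v, z} \<le> Max ((\<lambda>z. w 0 {v, z}) ` A)" if "z \<in> A" for z
    using A that by (intro Max_ge) auto
  ultimately have "m \<in> A" "\<And>z. z \<in> A \<Longrightarrow> w 0 {v, z} \<le> w 0 {v, m}" by auto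
  then have m: "{v, m} \<in> E" "card (neighbours E m) = 1"
    and longest: "\<And>z. {v, z} \<in> E \<Longrightarrow> card (neighbours E z) = 1 \<Longrightarrow> w 0 {v, z} \<le> w 0 {v, m}"
    by (auto simp: A_def neighbours_def)
  note diff = leaf_difference[OF l m]
  show ?thesis
  proof (cases "\<exists>t0\<ge>0. 0 < vertex_rate E (w t0) v - w t0 {v, m}")
    case True
    then obtain t0 where t0: "0 \<le> t0" "0 < vertex_rate E (w t0) v - w t0 {v, m}" by blast
    \<comment> \<open>The derivative of vl exceeds that of vm by w(vm) - w(vl), which is
      nonnegative.\<close>
    have "0 < vertex_rate E (w t) v + vertex_rate E (w t) l" if "t0 \<le> t" for t
    proof -
      have t: "0 \<le> t" using t0 that by simp
      have "w t {v, m} - w t {v, l} \<ge> 0" using diff[OF t] longest[OF l] by simp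
      then show ?thesis
        using longest_leaf_rate_persists[OF m v longest t0 that] vertex_rate_leaf[OF t l] by simp
    qed
    then show ?thesis
      using eventually_monotone_limitI_pos[OF weight_deriv[OF _ l(1)] _ t0(1)] weight_pos l(1)
      by (simp add: less_imp_le)
  next
    case False
    then have "vertex_rate E (w t) v + vertex_rate E (w t) m \<le> 0" if "0 \<le> t" for t
      using that vertex_rate_leaf[OF that m] by (simp add: not_less)
    then obtain L where L: "((\<lambda>t. w t {v, m}) \<longlongrightarrow> L) at_top"
      using deriv_nonpos_tendsto[OF weight_deriv[OF _ m(1)]] weight_pos m(1)
      by (metis less_imp_le)
    \<comment> \<open>The weight of vl differs from that of vm by a multiple of
      \<open>exp (- t)\<close>, so it has the same finite limit.\<close>
    have "((\<lambda>t::real. exp (- t)) \<longlongrightarrow> 0) at_top"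
      by (rule filterlim_compose[OF exp_at_bot filterlim_uminus_at_bot_at_top])
    then have "((\<lambda>t. w t {v, m} - (w 0 {v, m} - w 0 {v, l}) * exp (- t)) \<longlongrightarrow>
        L - (w 0 {v, m} - w 0 {v, l}) * 0) at_top"
      by (intro tendsto_intros L)
    moreover have "\<forall>\<^sub>F t in at_top. w t {v, m} - (w 0 {v, m} - w 0 {v, l}) * exp (- t) = w t {v, l}"
      using diff by (intro eventually_at_top_linorderI[of 0]) (simp add: algebra_simps)
    ultimately have "((\<lambda>t. w t {v, l}) \<longlongrightarrow> L - (w 0 {v, m} - w 0 {v, l}) * 0) at_top"
      by (rule Lim_transform_eventually)
    then show ?thesis
      using eventually_monotone_limitI_finite weight_pos l(1) by (metis less_imp_le)
  qed
qed

lemma edge_eventually_monotone_limit: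
  assumes "e \<in> E"
  shows "eventually_monotone_limit (\<lambda>t. w t e)"
proof -
  obtain x y where e: "e = {x, y}"
    using tree assms unfolding finite_tree_def finite_simple_graph_def by blast
  then have xy: "{x, y} \<in> E" "{y, x} \<in> E" using assms by (auto simp: insert_commute)
  consider "card (neighbours E y) = 1" | "card (neighbours E x) = 1"
    | "2 \<le> card (neighbours E x)" "2 \<le> card (neighbours E y)"
    using degree_pos[OF xy(1)] degree_pos[OF xy(2)] by linarith
  then show ?thesis
    unfolding e using leaf_edge[OF xy(1)] leaf_edge[OF xy(2)] internal_edge[OF xy(1)]
    by cases (simp_all add: insert_commute)
qed

end

theorem theorem1:
  fixes V :: "'a set" and E :: "'a set set" and w :: "real \<Rightarrow> 'a set \<Rightarrow> real"
  assumes "finite_tree V E"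
    and "ricci_flow V E w"
  shows "(\<forall>h\<in>E. \<exists>L::ereal. 0 \<le> L \<and> ((\<lambda>t. ereal (w t h)) \<longlongrightarrow> L) at_top) \<and>
         (\<forall>e\<in>E. ((\<lambda>t. ereal (w t e)) \<longlongrightarrow> \<infinity>) at_top \<longrightarrow>
            (\<exists>t0\<ge>0. strict_mono_on {t0..} (\<lambda>t. w t e)))"
proof -
  have "eventually_monotone_limit (\<lambda>t. w t e)" if "e \<in> E" for e
    using tree_ricci_flow.intro[OF assms] that
    by (rule tree_ricci_flow.edge_eventually_monotone_limit)
  then show ?thesis by (simp add: eventually_monotone_limit_def)
qed

end
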